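(* Let $A$ be a connected simple graph on $[n]$ with $n>2$, let $B=(b_{ij})$ be its binding graph on $[n_1]$, $n_1=n(n+1)/2$, and let $\hat B=(m_{ij})$ be the stable graph of $B$. Define $\Psi=(\psi_{ij})$ by $\psi_{ij}=x_0$ if $i\ne j$ and $b_{ij}=x_0$, and $\psi_{ij}=m_{ij}$ otherwise; and $\Phi=(\phi_{ij})$ by $\phi_{ij}=x_0$ if $i,j\in[n]$ and $i\ne j$, and $\phi_{ij}=\psi_{ij}$ otherwise. Then $\mathrm{Aut}(B)=\mathrm{Aut}(\hat B)=\mathrm{Aut}(\hat\Psi)=\mathrm{Aut}(\hat\Phi)=\mathrm{Aut}(\Phi)$.
   Context: Labels are independent commuting indeterminates $x_0,x_1,\dots$; $\mathrm{Var}=\{x_1,x_2,\dots\}$. A graph of order $N$ is a symmetric $N\times N$ matrix over $\{x_0\}\cup\mathrm{Var}$ on vertex set $[N]$; for $i\ne j$, $(i,j)$ is an edge iff the entry is not $x_0$. A simple graph has all diagonal entries $x_0$ and at most two distinct entries. An automorphism of $G$ is a permutation $\sigma$ of $[N]$ with $g_{i^\sigma j^\sigma}=g_{ij}$ for all $i,j$. Products/powers ($G^0=I$) are computed in the commutative polynomial ring over $\mathbb{R}$ in the indeterminates and an extra indeterminate $\lambda$. $A\approx B$ means $a_{ij}=a_{st}\iff b_{ij}=b_{st}$ for all $i,j,s,t$. An equivalent variable substitution replaces the entries of a matrix by variables of $\mathrm{Var}$, equal entries by equal variables and distinct by distinct. Description graph $\tilde G$: obtained from $\Gamma(G)=\sum_{k=0}^{N-1}\lambda^kG^k$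 by an equivalent variable substitution. Stable graph $\hat G$: iterate $G_0=G$, $G_{k+1}=\tilde{G_k}$ until the number of distinct entries stops increasing; the final graph (defined up to $\approx$) is $\hat G$. The binding graph $B$ of a simple graph $A$ on $[n]$ is the simple graph on $[n_1]$ whose subgraph induced on $[n]$ is $A$ and in which each pair of distinct $u,v\in[n]$ has a unique vertex $p\in\{n+1,\dots,n_1\}$ adjacent exactly to $u$ and $v$, binding edges carrying the same label as edges of $A$. *)

theory Defs
  imports
    "Jordan_Normal_Form.Matrix"
    "HOL-Library.Poly_Mapping"
    "HOL-Combinatorics.Permutations"
begin

text \<open>
  The index \<open>0\<close> is the non-edge label \<open>x\<^sub>0\<close>. Vertices are numbered from \<open>0\<close>, so
  \<open>[N]\<close> is \<open>{..<N}\<close>.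
\<close>

datatype label = X nat

definition Var :: "label set" where
  "Var = X ` {1..}"

definition is_graph :: "nat \<Rightarrow> label mat \<Rightarrow> bool" where
  "is_graph N G \<longleftrightarrow> G \<in> carrier_mat N N \<and> transpose_mat G = G"

definition edge :: "label mat \<Rightarrow> nat \<Rightarrow> nat \<Rightarrow> bool" where
  "edge G i j \<longleftrightarrow> i < dim_row G \<and> j < dim_col G \<and> i \<noteq> j \<and> G $$ (i, j) \<noteq> X 0"

definition is_simple_graph :: "nat \<Rightarrow> label mat \<Rightarrow> bool" where
  "is_simple_graph N G \<longleftrightarrow>
     is_graph N G \<and> (\<forall>i<N. G $$ (i, i) = X 0) \<and> card (elements_mat G) \<le> 2"

definition is_connected :: "label mat \<Rightarrow> bool" where
  "is_connected G \<longleftrightarrow> (\<forall>i<dim_row G. \<forall>j<dim_row G. (edge G)\<^sup>*\<^sup>* i j)"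

definition Aut :: "label mat \<Rightarrow> (nat \<Rightarrow> nat) set" where
  "Aut G = {\<sigma>. \<sigma> permutes {..<dim_row G} \<and>
     (\<forall>i<dim_row G. \<forall>j<dim_row G. G $$ (\<sigma> i, \<sigma> j) = G $$ (i, j))}"

text \<open>
  Multivariate polynomials over the reals: finitely supported maps from monomials to
  coefficients. The indeterminates are \<open>Some l\<close> for each label \<open>l\<close>, and \<open>None\<close>, which is
  \<open>\<lambda>\<close>.
\<close>

type_synonym label_poly = "(label option \<Rightarrow>\<^sub>0 nat) \<Rightarrow>\<^sub>0 real"

definition indet :: "label option \<Rightarrow> label_poly" where
  "indet v = Poly_Mapping.single (Poly_Mapping.single v 1) 1"

definition Gamma :: "label mat \<Rightarrow> label_poly mat" where
  "Gamma G = mat (dim_row G) (dim_row G)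
     (\<lambda>(i, j). \<Sum>k<dim_row G.
        indet None ^ k * (map_mat (\<lambda>l. indet (Some l)) G ^\<^sub>m k) $$ (i, j))"

definition equiv_subst :: "'a mat \<Rightarrow> label mat \<Rightarrow> bool" where
  "equiv_subst M D \<longleftrightarrow>
     (\<exists>f. inj_on f (elements_mat M) \<and> f ` elements_mat M \<subseteq> Var \<and> D = map_mat f M)"

definition is_description_graph :: "label mat \<Rightarrow> label mat \<Rightarrow> bool" where
  "is_description_graph G D \<longleftrightarrow> equiv_subst (Gamma G) D"

text \<open>
  Description and stable graphs are determined only up to the choice of variables, hence
  relations rather than functions. The stable graph is the last graph computed: the first
  one without more distinct entries than its predecessor. It is always over
  \<^const>\<open>Var\<close>.
\<close>

definition is_stable_graph :: "label mat \<Rightarrow> label mat \<Rightarrow> bool" where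
  "is_stable_graph G H \<longleftrightarrow>
     (\<exists>(S :: nat \<Rightarrow> label mat) K.
        S 0 = G \<and>
        (\<forall>k\<le>K. is_description_graph (S k) (S (Suc k))) \<and>
        (\<forall>k<K. card (elements_mat (S k)) < card (elements_mat (S (Suc k)))) \<and>
        \<not> card (elements_mat (S K)) < card (elements_mat (S (Suc K))) \<and>
        H = S (Suc K))"

definition is_binding_graph :: "nat \<Rightarrow> label mat \<Rightarrow> nat \<Rightarrow> label mat \<Rightarrow> bool" where
  "is_binding_graph n A n1 B \<longleftrightarrow>
     n1 = n * (n + 1) div 2 \<and>
     is_simple_graph n1 B \<and>
     (\<forall>i<n. \<forall>j<n. B $$ (i, j) = A $$ (i, j)) \<and>
     (\<forall>u<n. \<forall>v<n. u \<noteq> v \<longrightarrow> (\<exists>!p. p \<in> {n..<n1} \<and> {w. edge B p w} = {u, v})) \<and>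
     (\<forall>u<n. \<forall>p\<in>{n..<n1}. \<forall>s t. edge B u p \<longrightarrow> edge A s t \<longrightarrow> B $$ (u, p) = A $$ (s, t))"

lemma ex_description_graph: "\<exists>D. is_description_graph G D"
proof -
  let ?E = "elements_mat (Gamma G)"
  have fin: "finite ?E"
    by (simp add: elements_mat_def)
  then obtain h :: "label_poly \<Rightarrow> nat" where h: "inj_on h ?E"
    using finite_imp_inj_to_nat_seg by blast
  have "inj_on (\<lambda>x. X (Suc (h x))) ?E"
    using h by (auto simp: inj_on_def)
  moreover have "(\<lambda>x. X (Suc (h x))) ` ?E \<subseteq> Var"
    by (auto simp: Var_def)
  ultimately show ?thesis
    unfolding is_description_graph_def equiv_subst_def by blast
qed

lemma ex_stable_graph: "\<exists>H. is_stable_graph G H"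
proof -
  define D where "D G = (SOME H. is_description_graph G H)" for G
  have D: "is_description_graph G (D G)" for G
    unfolding D_def using ex_description_graph by (rule someI_ex)
  define S where "S k = (D ^^ k) G" for k
  have S: "S 0 = G" "\<And>k. S (Suc k) = D (S k)"
    by (simp_all add: S_def)
  let ?c = "\<lambda>k. card (elements_mat (S k))"
  have dims: "dim_row (D M) = dim_row M \<and> dim_col (D M) = dim_row M" for M
    using D[of M] by (auto simp: is_description_graph_def equiv_subst_def Gamma_def)
  have row: "dim_row (S k) = dim_row G" for k
    by (induction k) (simp_all add: S dims)
  have bound: "?c (Suc k) \<le> dim_row G * dim_row G" for k
  proof -
    let ?I = "{..<dim_row G} \<times> {..<dim_row G}"
    have "elements_mat (S (Suc k)) \<subseteq> (\<lambda>ij. S (Suc k) $$ ij) ` ?I"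
      using row[of k] by (fastforce simp: S dims dest: elements_matD)
    then have "?c (Suc k) \<le> card ?I"
      by (rule surj_card_le[rotated]) simp
    then show ?thesis
      by simp
  qed
  have "\<exists>k. \<not> ?c k < ?c (Suc k)"
  proof (rule ccontr)
    assume "\<not> ?thesis"
    then have less: "?c k < ?c (Suc k)" for k
      by blast
    have "k \<le> ?c k" for k
    proof (induction k)
      case (Suc k)
      then show ?case
        using less[of k] by linarith
    qed simp
    from this[of "Suc (dim_row G * dim_row G)"] bound[of "dim_row G * dim_row G"]
    show False
      by linarith
  qed
  then obtain K where K: "\<not> ?c K < ?c (Suc K)" "\<forall>k<K. ?c k < ?c (Suc k)"
    using exists_least_iff[of "\<lambda>k. \<not> ?c k < ?c (Suc k)"] by blast
  have "is_stable_graph G (S (Suc K))"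
    unfolding is_stable_graph_def
    by (intro exI[of _ S] exI[of _ K]) (use S D K in auto)
  then show ?thesis ..
qed

end

(*
For every symmetric G of order at least 2 the coefficient of lambda in Gamma(G) is G itself, so a
description graph separates at least as many pairs as G, while every automorphism of G preserves all
powers of G. Hence Aut is unchanged under stabilisation, and what remains is to recover B from Phi.
The diagonal labels of M refine the diagonal of Gamma(B). The diagonal of B^2 counts degrees, which
separates binding vertices (degree 2) from [n] (degree at least 3 by connectedness and n > 2).
The diagonal of B^3 counts closed walks of length 3: the binding vertex of u and v lies on a triangle
iff uv is an edge of A. So the edges of A that Phi forgets are recorded in its diagonal.
*)

theory Submission
  imports Defs
begin

section \<open>Separating the summands of \<open>Gamma\<close> by their degree in \<lambda>\<close>

abbreviation poly_mat :: "label mat \<Rightarrow> label_poly mat" where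
  "poly_mat G \<equiv> map_mat (\<lambda>l. indet (Some l)) G"

lemma lookup_single_times:
  fixes f :: "'a::cancel_comm_monoid_add \<Rightarrow>\<^sub>0 'b::semiring_1"
  shows "Poly_Mapping.lookup (Poly_Mapping.single a 1 * f) (a + m) = Poly_Mapping.lookup f m"
  by transfer (simp add: prod_fun_def when_mult)

text \<open>\<open>None\<close> stands for \<lambda>, so this says that no monomial of
  \<open>p\<close> involves \<lambda>. The entries of powers of \<open>poly_mat G\<close> have this
  form, which lets the \<lambda>-degree tell the powers apart.\<close>

definition lambda_free :: "label_poly \<Rightarrow> bool" where
  "lambda_free p \<longleftrightarrow> (\<forall>m\<in>Poly_Mapping.keys p. Poly_Mapping.lookup m None = 0)"

lemma lambda_free_intros:
  "lambda_free 0" "lambda_free 1" "lambda_free (indet (Some l))"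
  "lambda_free p \<Longrightarrow> lambda_free q \<Longrightarrow> lambda_free (p + q)"
  "lambda_free p \<Longrightarrow> lambda_free q \<Longrightarrow> lambda_free (p * q)"
      apply (simp_all add: lambda_free_def indet_def lookup_single)
  subgoal using keys_add[of p q] by blast
  subgoal using keys_mult[of p q] by (fastforce simp: lookup_add)
  done

lemma lambda_free_sum: "(\<And>x. x \<in> I \<Longrightarrow> lambda_free (f x)) \<Longrightarrow> lambda_free (sum f I)"
  by (induction I rule: infinite_finite_induct) (auto intro: lambda_free_intros)

lemma indet_power: "indet v ^ k = Poly_Mapping.single (Poly_Mapping.single v k) 1"
  by (induction k) (simp_all add: indet_def mult_single flip: single_add)

text \<open>Since \<open>p\<close> is free of \<lambda>, every monomial of
  \<open>indet None ^ j * p\<close> has \<lambda>-degree exactly \<open>j\<close>, whereas the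
  monomial looked up has \<lambda>-degree \<open>k\<close>.\<close>

lemma lookup_lambda_power_times:
  assumes "lambda_free p" and "Poly_Mapping.lookup m None = 0"
  shows "Poly_Mapping.lookup (indet None ^ j * p) (Poly_Mapping.single None k + m) = (if j = k then Poly_Mapping.lookup p m else 0)"
proof (cases "j = k")
  case True
  then show ?thesis
    by (simp add: indet_power lookup_single_times)
next
  case False
  have "Poly_Mapping.single None k + m \<notin> Poly_Mapping.keys (indet None ^ j * p)"
  proof
    assume "Poly_Mapping.single None k + m \<in> Poly_Mapping.keys (indet None ^ j * p)"
    then obtain c where "c \<in> Poly_Mapping.keys p" "Poly_Mapping.single None k + m = Poly_Mapping.single None j + c"
      using keys_mult[of "indet None ^ j" p] by (auto simp: indet_power)
    then have "k = j"
      using assms by (metis add.right_neutral lambda_free_def lookup_add lookup_single_eq)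
    with False show False by simp
  qed
  then show ?thesis
    using False by (simp add: in_keys_iff)
qed

text \<open>The coefficients at monomials of \<lambda>-degree \<open>k\<close> see only the
  \<open>k\<close>-th summand, so a polynomial in \<lambda> determines its \<lambda>-free
  coefficients.\<close>

lemma lambda_expansion_unique:
  assumes eq: "(\<Sum>k<N. indet None ^ k * f k) = (\<Sum>k<N. indet None ^ k * g k)"
    and free: "\<And>k. k < N \<Longrightarrow> lambda_free (f k)" "\<And>k. k < N \<Longrightarrow> lambda_free (g k)"
    and "k < N"
  shows "f k = g k"
proof (rule poly_mapping_eqI)
  fix m
  have coeff: "Poly_Mapping.lookup (\<Sum>k<N. indet None ^ k * h k) (Poly_Mapping.single None k + m) = Poly_Mapping.lookup (h k) m"
    if "\<And>k. k < N \<Longrightarrow> lambda_free (h k)" "Poly_Mapping.lookup m None = 0" for h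
    using that \<open>k < N\<close> by (simp add: lookup_sum lookup_lambda_power_times)
  show "Poly_Mapping.lookup (f k) m = Poly_Mapping.lookup (g k) m"
  proof (cases "Poly_Mapping.lookup m None = 0")
    case True
    show ?thesis
      using coeff[of f] coeff[of g] free True eq by simp
  next
    \<comment> \<open>A monomial containing \<lambda> has coefficient 0 in both \<lambda>-free
      polynomials.\<close>
    case False
    then have "m \<notin> Poly_Mapping.keys (f k)" "m \<notin> Poly_Mapping.keys (g k)"
      using free \<open>k < N\<close> by (auto simp: lambda_free_def)
    then show ?thesis
      by (simp add: in_keys_iff)
  qed
qed

section \<open>Matrix powers of a graph and the entries of \<open>Gamma\<close>\<close>

lemma mult_mat_entry:
  assumes "P \<in> carrier_mat N N" "Q \<in> carrier_mat N N" "i < N" "j < N"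
  shows "(P * Q) $$ (i, j) = (\<Sum>w<N. P $$ (i, w) * Q $$ (w, j))"
  using assms by (auto simp: scalar_prod_def atLeast0LessThan)

lemma poly_mat_power_Suc:
  assumes G: "G \<in> carrier_mat N N" and ij: "i < N" "j < N"
  shows "(poly_mat G ^\<^sub>m Suc k) $$ (i, j) =
    (\<Sum>w<N. (poly_mat G ^\<^sub>m k) $$ (i, w) * indet (Some (G $$ (w, j))))"
proof -
  have "poly_mat G ^\<^sub>m k \<in> carrier_mat N N" "poly_mat G \<in> carrier_mat N N"
    using G by (simp_all add: pow_carrier_mat)
  from mult_mat_entry[OF this ij] show ?thesis
    using G ij by simp
qed

lemma lambda_free_poly_mat_power:
  assumes "G \<in> carrier_mat N N" "i < N" "j < N"
  shows "lambda_free ((poly_mat G ^\<^sub>m k) $$ (i, j))"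
  using assms(2,3)
proof (induction k arbitrary: i j)
  case 0
  then show ?case
    using assms(1) by (simp add: lambda_free_intros)
next
  case (Suc k)
show ?case
    unfolding poly_mat_power_Suc[OF assms(1) Suc.prems]
    using Suc by (intro lambda_free_sum lambda_free_intros(5) lambda_free_intros(3)) auto
qed

lemma indet_inject: "indet v = indet w \<longleftrightarrow> v = w"
proof
  assume "indet v = indet w"
  then have "Poly_Mapping.keys (indet v) = Poly_Mapping.keys (indet w)"
    by simp
  then have "Poly_Mapping.keys (Poly_Mapping.single v (1::nat)) = Poly_Mapping.keys (Poly_Mapping.single w (1::nat))"
    by (simp add: indet_def)
  then show "v = w"
    by simp
qed simp

lemma Gamma_eq_imp_power_eq:
  assumes "G \<in> carrier_mat N N" "i < N" "j < N" "s < N" "t < N"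
    and "Gamma G $$ (i, j) = Gamma G $$ (s, t)" "k < N"
  shows "(poly_mat G ^\<^sub>m k) $$ (i, j) = (poly_mat G ^\<^sub>m k) $$ (s, t)"
  using assms
  by (intro lambda_expansion_unique[where N = N and f = "\<lambda>k. (poly_mat G ^\<^sub>m k) $$ (i, j)"
        and g = "\<lambda>k. (poly_mat G ^\<^sub>m k) $$ (s, t)"])
    (auto simp: Gamma_def lambda_free_poly_mat_power)

text \<open>The power with exponent 1 is the matrix of labels itself, and distinct labels give
  distinct indeterminates. The exponents in \<open>Gamma G\<close> run below \<open>N\<close>, so
  \<open>N \<ge> 2\<close> is what makes exponent 1 occur.\<close>

lemma Gamma_eq_imp_eq:
  assumes "G \<in> carrier_mat N N" "i < N" "j < N" "s < N" "t < N"
    and "Gamma G $$ (i, j) = Gamma G $$ (s, t)" "N \<ge> 2"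
  shows "G $$ (i, j) = G $$ (s, t)"
proof -
  have "(poly_mat G ^\<^sub>m 1) $$ (i, j) = (poly_mat G ^\<^sub>m 1) $$ (s, t)"
    using assms Gamma_eq_imp_power_eq[OF assms(1-6), of 1] by simp
  moreover have "poly_mat G ^\<^sub>m 1 = poly_mat G"
    using assms(1) left_mult_one_mat'[of "poly_mat G"] by simp
  ultimately show ?thesis
    using assms(1-5) by (simp add: indet_inject)
qed

text \<open>An automorphism carries walks to walks with the same sequence of labels, so it preserves
  the entries of every power.\<close>

lemma Gamma_automorphism:
  assumes G: "G \<in> carrier_mat N N" and \<sigma>: "\<sigma> \<in> Aut G" and ij: "i < N" "j < N"
  shows "Gamma G $$ (\<sigma> i, \<sigma> j) = Gamma G $$ (i, j)"
proof -
  have perm: "\<sigma> permutes {..<N}"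
    and inv: "\<And>i j. i < N \<Longrightarrow> j < N \<Longrightarrow> G $$ (\<sigma> i, \<sigma> j) = G $$ (i, j)"
    using G \<sigma> by (auto simp: Aut_def)
  have lt: "\<sigma> i < N \<longleftrightarrow> i < N" for i
    using permutes_in_image[OF perm] by simp
  have "(poly_mat G ^\<^sub>m k) $$ (\<sigma> i, \<sigma> j) = (poly_mat G ^\<^sub>m k) $$ (i, j)" for k
    using ij
  proof (induction k arbitrary: i j)
    case 0
    then show ?case
      using G permutes_inj[OF perm] by (auto simp: lt inj_eq)
  next
    case (Suc k)
    let ?P = "poly_mat G ^\<^sub>m k"
    \<comment> \<open>The intermediate vertex is renamed to \<open>\<sigma> w\<close>, which again
      runs over all vertices because \<sigma> is a permutation.\<close>
    have "(\<Sum>w<N. ?P $$ (\<sigma> i, w) * indet (Some (G $$ (w, \<sigma> j)))) =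
        (\<Sum>w<N. ?P $$ (\<sigma> i, \<sigma> w) * indet (Some (G $$ (\<sigma> w, \<sigma> j))))"
      by (subst sum.permute[OF perm]) simp
    also have "\<dots> = (\<Sum>w<N. ?P $$ (i, w) * indet (Some (G $$ (w, j))))"
      using Suc by (intro sum.cong) (auto simp: inv)
    finally show ?case
      using Suc.prems by (simp add: poly_mat_power_Suc[OF G] lt del: pow_mat.simps)
  qed
  then show ?thesis
    using G ij by (simp add: Gamma_def lt)
qed

section \<open>Description graphs, stable graphs and their automorphisms\<close>

lemma description_graph_carrier:
  "is_description_graph G D \<Longrightarrow> G \<in> carrier_mat N N \<Longrightarrow> D \<in> carrier_mat N N"
  by (auto simp: is_description_graph_def equiv_subst_def Gamma_def)

lemma description_graph_eq_iff:
  assumes "is_description_graph G D" "G \<in> carrier_mat N N" "i < N" "j < N" "s < N" "t < N"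
  shows "D $$ (i, j) = D $$ (s, t) \<longleftrightarrow> Gamma G $$ (i, j) = Gamma G $$ (s, t)"
proof -
  have car: "Gamma G \<in> carrier_mat N N"
    using assms(2) by (simp add: Gamma_def)
  obtain f where f: "inj_on f (elements_mat (Gamma G))" "D = map_mat f (Gamma G)"
    using assms(1) by (auto simp: is_description_graph_def equiv_subst_def)
  have "Gamma G $$ (i, j) \<in> elements_mat (Gamma G)" "Gamma G $$ (s, t) \<in> elements_mat (Gamma G)"
    by (rule elements_matI[OF car]; simp add: assms)+
  then show ?thesis
    using f car assms(3-) inj_on_eq_iff[OF f(1)] by simp
qed

lemma description_graph_in_Var:
  assumes "is_description_graph G D" "G \<in> carrier_mat N N" "i < N" "j < N"
  shows "D $$ (i, j) \<in> Var"
proof -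
  have car: "Gamma G \<in> carrier_mat N N"
    using assms(2) by (simp add: Gamma_def)
  obtain f where f: "f ` elements_mat (Gamma G) \<subseteq> Var" "D = map_mat f (Gamma G)"
    using assms(1) by (auto simp: is_description_graph_def equiv_subst_def)
  have "Gamma G $$ (i, j) \<in> elements_mat (Gamma G)"
    by (rule elements_matI[OF car]; simp add: assms)
  then show ?thesis
    using f(1) car assms(3-) unfolding f(2) by (simp add: image_subset_iff)
qed

lemma Aut_iff:
  assumes "G \<in> carrier_mat N N"
  shows "\<sigma> \<in> Aut G \<longleftrightarrow> \<sigma> permutes {..<N} \<and> (\<forall>i<N. \<forall>j<N. G $$ (\<sigma> i, \<sigma> j) = G $$ (i, j))"
  using assms by (simp add: Aut_def)

text \<open>Equality in \<open>D\<close> is equality in \<open>Gamma G\<close>. This implies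
  equality in \<open>G\<close>, giving one inclusion; the other holds because automorphisms of
  \<open>G\<close> preserve \<open>Gamma G\<close>.\<close>

lemma Aut_description_graph:
  assumes D: "is_description_graph G D" and G: "G \<in> carrier_mat N N" and N: "N \<ge> 2"
  shows "Aut D = Aut G"
proof -
  note D_car = description_graph_carrier[OF D G]
  have "\<sigma> \<in> Aut D \<longleftrightarrow> \<sigma> \<in> Aut G" for \<sigma>
  proof (cases "\<sigma> permutes {..<N}")
    case True
    have lt: "\<sigma> i < N" if "i < N" for i
      using permutes_in_image[OF True] that by simp
    have D_eq: "D $$ (\<sigma> i, \<sigma> j) = D $$ (i, j) \<longleftrightarrow> Gamma G $$ (\<sigma> i, \<sigma> j) = Gamma G $$ (i, j)"
      if "i < N" "j < N" for i j
      using that by (intro description_graph_eq_iff[OF D G] lt)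
    show ?thesis
    proof
      assume "\<sigma> \<in> Aut D"
      then have "G $$ (\<sigma> i, \<sigma> j) = G $$ (i, j)" if "i < N" "j < N" for i j
        using that Gamma_eq_imp_eq[OF G lt lt that _ N] D_eq[OF that]
        unfolding Aut_iff[OF D_car] by blast
      then show "\<sigma> \<in> Aut G"
        using True unfolding Aut_iff[OF G] by blast
    next
      assume "\<sigma> \<in> Aut G"
      then show "\<sigma> \<in> Aut D"
        using Gamma_automorphism[OF G] D_eq True unfolding Aut_iff[OF D_car] by blast
    qed
  qed (simp add: Aut_iff[OF D_car] Aut_iff[OF G])
  then show ?thesis
    by blast
qed

text \<open>All four facts pass along the iteration. Since \<open>H\<close> is
  \<open>S (Suc K)\<close>, at least one description step has been made; hence the labels lie in
  \<open>Var\<close>, and \<open>H\<close> refines \<open>Gamma G\<close> rather than merely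
  \<open>G\<close>.\<close>

lemma stable_graph_properties:
  assumes stable: "is_stable_graph G H" and G: "G \<in> carrier_mat N N" and N: "N \<ge> 2"
  shows Aut_stable_graph: "Aut H = Aut G"
    and stable_graph_in_Var: "\<And>i j. i < N \<Longrightarrow> j < N \<Longrightarrow> H $$ (i, j) \<in> Var"
    and stable_graph_refines_Gamma: "\<And>i j s t. \<lbrakk>i < N; j < N; s < N; t < N; H $$ (i, j) = H $$ (s, t)\<rbrakk>
      \<Longrightarrow> Gamma G $$ (i, j) = Gamma G $$ (s, t)"
    and stable_graph_carrier: "H \<in> carrier_mat N N"
proof -
  obtain S K where S0: "S 0 = G"
    and desc: "\<And>k. k \<le> K \<Longrightarrow> is_description_graph (S k) (S (Suc k))"
    and H: "H = S (Suc K)"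
    using stable by (auto simp: is_stable_graph_def)
  have car: "k \<le> Suc K \<Longrightarrow> S k \<in> carrier_mat N N" for k
  proof (induction k)
    case (Suc k)
    then show ?case
      using description_graph_carrier[OF desc, of k] by simp
  qed (simp add: S0 G)
  show "H \<in> carrier_mat N N"
    using car H by simp
  have "k \<le> Suc K \<Longrightarrow> Aut (S k) = Aut G" for k
  proof (induction k)
    case (Suc k)
    then show ?case
      using Aut_description_graph[OF desc car N, of k] by simp
  qed (simp add: S0)
  then show "Aut H = Aut G"
    using H by simp
  show "H $$ (i, j) \<in> Var" if "i < N" "j < N" for i j
    using description_graph_in_Var[OF desc[of K] car[of K] that] H by simp
  have "\<lbrakk>k \<le> K; i < N; j < N; s < N; t < N; S (Suc k) $$ (i, j) = S (Suc k) $$ (s, t)\<rbrakk>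
      \<Longrightarrow> Gamma G $$ (i, j) = Gamma G $$ (s, t)" for k i j s t
  proof (induction k)
    case 0
    then show ?case
      using description_graph_eq_iff[OF desc[of 0] car[of 0], of i j s t] S0 by simp
  next
    case (Suc k)
    \<comment> \<open>Equality is traced back one stage: from \<open>S (Suc (Suc k))\<close> to the
      \<open>Gamma\<close> of its predecessor, and from there to the predecessor itself.\<close>
    then have "Gamma (S (Suc k)) $$ (i, j) = Gamma (S (Suc k)) $$ (s, t)"
      using description_graph_eq_iff[OF desc[of "Suc k"] car[of "Suc k"], of i j s t] by simp
    then have "S (Suc k) $$ (i, j) = S (Suc k) $$ (s, t)"
      using Gamma_eq_imp_eq[OF car[of "Suc k"], of i j s t] Suc.prems N by simp
    then show ?case
      using Suc by simp
  qed
  then show "Gamma G $$ (i, j) = Gamma G $$ (s, t)"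
    if "i < N" "j < N" "s < N" "t < N" "H $$ (i, j) = H $$ (s, t)" for i j s t
    using that H by blast
qed

section \<open>Closed walks of length 2 and 3 in simple graphs\<close>

lemma single_add_eq_single_2_iff:
  "Poly_Mapping.single a (1::nat) + Poly_Mapping.single b 1 = Poly_Mapping.single c 2 \<longleftrightarrow> a = c \<and> b = c"
proof
  assume eq: "Poly_Mapping.single a (1::nat) + Poly_Mapping.single b 1 = Poly_Mapping.single c 2"
  show "a = c \<and> b = c"
    using arg_cong[OF eq, of "\<lambda>m. Poly_Mapping.lookup m a"] arg_cong[OF eq, of "\<lambda>m. Poly_Mapping.lookup m b"]
    unfolding lookup_add lookup_single when_def by (auto split: if_splits)
qed (simp add: eval_nat_numeral flip: single_add)

lemma single_add_eq_single_3_iff: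
  "Poly_Mapping.single a (1::nat) + Poly_Mapping.single b 1 + Poly_Mapping.single c 1 = Poly_Mapping.single d 3
    \<longleftrightarrow> a = d \<and> b = d \<and> c = d"
proof
  assume eq: "Poly_Mapping.single a (1::nat) + Poly_Mapping.single b 1 + Poly_Mapping.single c 1 = Poly_Mapping.single d 3"
  show "a = d \<and> b = d \<and> c = d"
    using arg_cong[OF eq, of "\<lambda>m. Poly_Mapping.lookup m a"] arg_cong[OF eq, of "\<lambda>m. Poly_Mapping.lookup m b"]
      arg_cong[OF eq, of "\<lambda>m. Poly_Mapping.lookup m c"]
    unfolding lookup_add lookup_single when_def by (auto split: if_splits)
qed (simp add: eval_nat_numeral flip: single_add)

text \<open>The coefficient of a pure square picks out the walks of length 2 whose steps both carry
  the label \<open>c\<close>; the cubic version does the same for length 3.\<close>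

lemma lookup_indet_product_2:
  "Poly_Mapping.lookup (indet a * indet b) (Poly_Mapping.single c 2) = of_bool (a = c \<and> b = c)"
  unfolding indet_def mult_single lookup_single single_add_eq_single_2_iff by (simp add: when_def)

lemma lookup_indet_product_3:
  "Poly_Mapping.lookup (indet a * indet b * indet c) (Poly_Mapping.single d 3) = of_bool (a = d \<and> b = d \<and> c = d)"
  unfolding indet_def mult_single lookup_single single_add_eq_single_3_iff by (simp add: when_def)

lemma poly_mat_power_1:
  assumes "G \<in> carrier_mat N N" "i < N" "j < N"
  shows "(poly_mat G ^\<^sub>m 1) $$ (i, j) = indet (Some (G $$ (i, j)))"
  using assms left_mult_one_mat'[of "poly_mat G"] by simp

lemma poly_mat_power_2:
  assumes "G \<in> carrier_mat N N" "i < N" "j < N"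
  shows "(poly_mat G ^\<^sub>m 2) $$ (i, j) = (\<Sum>w<N. indet (Some (G $$ (i, w))) * indet (Some (G $$ (w, j))))"
proof -
  have "(poly_mat G ^\<^sub>m 2) $$ (i, j) = (poly_mat G ^\<^sub>m Suc 1) $$ (i, j)"
    by (simp add: numeral_2_eq_2)
  also have "\<dots> = (\<Sum>w<N. indet (Some (G $$ (i, w))) * indet (Some (G $$ (w, j))))"
    unfolding poly_mat_power_Suc[OF assms]
    by (rule sum.cong) (use poly_mat_power_1[OF assms(1,2)] in auto)
  finally show ?thesis .
qed

lemma poly_mat_power_3:
  assumes "G \<in> carrier_mat N N" "i < N" "j < N"
  shows "(poly_mat G ^\<^sub>m 3) $$ (i, j) =
    (\<Sum>w<N. \<Sum>u<N. indet (Some (G $$ (i, u))) * indet (Some (G $$ (u, w))) * indet (Some (G $$ (w, j))))"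
proof -
  have "(poly_mat G ^\<^sub>m 3) $$ (i, j) = (poly_mat G ^\<^sub>m Suc 2) $$ (i, j)"
    by (simp add: numeral_3_eq_3 numeral_2_eq_2)
  also have "\<dots> = (\<Sum>w<N. (\<Sum>u<N. indet (Some (G $$ (i, u))) * indet (Some (G $$ (u, w)))) * indet (Some (G $$ (w, j))))"
    unfolding poly_mat_power_Suc[OF assms]
    by (rule sum.cong) (use poly_mat_power_2[OF assms(1,2)] in auto)
  finally show ?thesis
    by (simp add: sum_distrib_right)
qed

lemma edge_iff:
  "G \<in> carrier_mat N N \<Longrightarrow> edge G i j \<longleftrightarrow> i < N \<and> j < N \<and> i \<noteq> j \<and> G $$ (i, j) \<noteq> X 0"
  by (simp add: edge_def)

lemma edge_commute:
  assumes "is_graph N G"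
  shows "edge G i j \<longleftrightarrow> edge G j i"
proof -
  have car: "G \<in> carrier_mat N N" and T: "transpose_mat G = G"
    using assms by (simp_all add: is_graph_def)
  have "transpose_mat G $$ (i, j) = G $$ (j, i)" if "i < N" "j < N"
    using that car by simp
  then have "G $$ (i, j) = G $$ (j, i)" if "i < N" "j < N"
    unfolding T using that by blast
  then show ?thesis
    unfolding edge_iff[OF car] by (cases "i < N \<and> j < N") auto
qed

text \<open>The diagonal contributes the entry \<open>X 0\<close>, which leaves room for only one
  further label, shared by all edges. Label equations thus become edge conditions.\<close>

lemma simple_graph_label_eq_iff_edge:
  assumes "is_simple_graph N G" "edge G s t" "i < N" "j < N"
  shows "G $$ (i, j) = G $$ (s, t) \<longleftrightarrow> edge G i j"
proof -
  have car: "G \<in> carrier_mat N N" and diag: "\<And>i. i < N \<Longrightarrow> G $$ (i, i) = X 0"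
    and card: "card (elements_mat G) \<le> 2"
    using assms(1) by (auto simp: is_simple_graph_def is_graph_def)
  have st: "s < N" "t < N" "G $$ (s, t) \<noteq> X 0"
    using assms(2) by (simp_all add: edge_iff[OF car])
  show ?thesis
  proof (cases "edge G i j")
    case True
    have "{X 0, G $$ (i, j), G $$ (s, t)} \<subseteq> elements_mat G"
      using diag[OF assms(3)] elements_matI[OF car assms(3,3) refl]
        elements_matI[OF car assms(3,4) refl] elements_matI[OF car st(1,2) refl] by simp
    then have "card {X 0, G $$ (i, j), G $$ (s, t)} \<le> 2"
      by (rule order_trans[OF card_mono card, rotated]) (simp add: elements_mat_def)
    then show ?thesis
      using True st(3) unfolding edge_iff[OF car] by (auto simp: card_insert_if split: if_splits)
  next
    case False
    then have "G $$ (i, j) = X 0"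
      using diag[of i] assms(3,4) unfolding edge_iff[OF car] by auto
    then show ?thesis
      using False st(3) by auto
  qed
qed

lemma simple_graph_AutI:
  assumes G: "is_simple_graph N G" and perm: "\<sigma> permutes {..<N}"
    and edges: "\<And>i j. i < N \<Longrightarrow> j < N \<Longrightarrow> edge G (\<sigma> i) (\<sigma> j) \<longleftrightarrow> edge G i j"
  shows "\<sigma> \<in> Aut G"
proof -
  have car: "G \<in> carrier_mat N N" and diag: "\<And>i. i < N \<Longrightarrow> G $$ (i, i) = X 0"
    using G by (auto simp: is_simple_graph_def is_graph_def)
  have lt: "\<sigma> i < N \<longleftrightarrow> i < N" for i
    using permutes_in_image[OF perm] by simp
  have "G $$ (\<sigma> i, \<sigma> j) = G $$ (i, j)" if ij: "i < N" "j < N" for i j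
  proof (cases "edge G i j")
    case True
    then show ?thesis
      using simple_graph_label_eq_iff_edge[OF G True, of "\<sigma> i" "\<sigma> j"] edges[OF ij] ij lt by simp
  next
    case False
    then have "\<not> edge G (\<sigma> i) (\<sigma> j)"
      using edges[OF ij] by simp
    have zero: "G $$ (a, b) = X 0" if "a < N" "b < N" "\<not> edge G a b" for a b
      using that diag[of a] unfolding edge_iff[OF car] by (cases "a = b") simp_all
    show ?thesis
      using zero[OF ij False] zero[of "\<sigma> i" "\<sigma> j"] \<open>\<not> edge G (\<sigma> i) (\<sigma> j)\<close> ij lt by simp
  qed
  then show ?thesis
    unfolding Aut_iff[OF car] using perm by blast
qed

text \<open>Let \<open>x\<close> be the common edge label. The coefficient of \<open>x\<close>
  squared in a diagonal entry of the second power counts closed walks of length 2, which is the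
  degree. Exponent 2 occurs in \<open>Gamma G\<close> because \<open>N \<ge> 3\<close>.\<close>

lemma Gamma_diag_degree:
  assumes G: "is_simple_graph N G" and lt: "i < N" "s < N" and N: "N \<ge> 3"
    and eq: "Gamma G $$ (i, i) = Gamma G $$ (s, s)"
  shows "card {w. edge G i w} = card {w. edge G s w}"
proof (cases "\<exists>u v. edge G u v")
  case True
  then obtain u v where uv: "edge G u v" by blast
  have car: "G \<in> carrier_mat N N" and graph: "is_graph N G"
    using G by (auto simp: is_simple_graph_def is_graph_def)
  note lab = simple_graph_label_eq_iff_edge[OF G uv]
  have "Poly_Mapping.lookup ((poly_mat G ^\<^sub>m 2) $$ (a, a)) (Poly_Mapping.single (Some (G $$ (u, v))) 2) =
      real (card {w. edge G a w})" if a: "a < N" for a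
  proof -
    have "Poly_Mapping.lookup ((poly_mat G ^\<^sub>m 2) $$ (a, a)) (Poly_Mapping.single (Some (G $$ (u, v))) 2) =
      (\<Sum>w<N. of_bool (edge G a w \<and> edge G w a))"
      using a by (simp add: poly_mat_power_2[OF car] lookup_sum lookup_indet_product_2 lab)
    also have "\<dots> = real (card ({..<N} \<inter> {w. edge G a w \<and> edge G w a}))"
      by (intro sum_of_bool_eq finite_lessThan)
    also have "{..<N} \<inter> {w. edge G a w \<and> edge G w a} = {w. edge G a w}"
      using edge_commute[OF graph] by (auto simp: edge_iff[OF car])
    finally show ?thesis .
  qed
  from this[OF lt(1)] this[OF lt(2)] show ?thesis
    using Gamma_eq_imp_power_eq[OF car lt(1,1) lt(2,2) eq, of 2] N by simp
qed simp

text \<open>The coefficient of the cube of the edge label in a diagonal entry of the third power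
  counts closed walks along three edges, so it vanishes exactly when there is no triangle. Exponent
  3 occurs because \<open>N \<ge> 4\<close>.\<close>

lemma Gamma_diag_triangle:
  assumes G: "is_simple_graph N G" and lt: "i < N" "s < N" and N: "N \<ge> 4"
    and eq: "Gamma G $$ (i, i) = Gamma G $$ (s, s)"
  shows "(\<exists>u w. edge G i u \<and> edge G u w \<and> edge G w i) \<longleftrightarrow> (\<exists>u w. edge G s u \<and> edge G u w \<and> edge G w s)"
    (is "?T i \<longleftrightarrow> ?T s")
proof (cases "\<exists>u v. edge G u v")
  case True
  then obtain u v where uv: "edge G u v" by blast
  have car: "G \<in> carrier_mat N N"
    using G by (auto simp: is_simple_graph_def is_graph_def)
  note lab = simple_graph_label_eq_iff_edge[OF G uv]
  have coeff: "\<not> (\<exists>u w. edge G a u \<and> edge G u w \<and> edge G w a) \<longleftrightarrow>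
      Poly_Mapping.lookup ((poly_mat G ^\<^sub>m 3) $$ (a, a)) (Poly_Mapping.single (Some (G $$ (u, v))) 3) = 0"
    if a: "a < N" for a
  proof -
    have "Poly_Mapping.lookup ((poly_mat G ^\<^sub>m 3) $$ (a, a)) (Poly_Mapping.single (Some (G $$ (u, v))) 3) =
      (\<Sum>w<N. \<Sum>u<N. of_bool (edge G a u \<and> edge G u w \<and> edge G w a))"
      using a by (simp add: poly_mat_power_3[OF car] lookup_sum lookup_indet_product_3 lab)
    also have "\<dots> = 0 \<longleftrightarrow> (\<forall>w<N. \<forall>u<N. \<not> (edge G a u \<and> edge G u w \<and> edge G w a))"
      by (auto simp: sum_nonneg_eq_0_iff sum_nonneg)
    also have "\<dots> \<longleftrightarrow> \<not> (\<exists>u w. edge G a u \<and> edge G u w \<and> edge G w a)"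
      using edge_iff[OF car] by blast
    finally show ?thesis ..
  qed
  have "(poly_mat G ^\<^sub>m 3) $$ (i, i) = (poly_mat G ^\<^sub>m 3) $$ (s, s)"
    using Gamma_eq_imp_power_eq[OF car lt(1,1) lt(2,2) eq, of 3] N by simp
  then have "(\<not> ?T i) = (\<not> ?T s)"
    unfolding coeff[OF lt(1)] coeff[OF lt(2)] by simp
  then show ?thesis
    by argo
qed simp

section \<open>Base vertices and binding vertices of the binding graph\<close>

locale binding_graph =
  fixes n n1 :: nat and A B :: "label mat"
  assumes n: "n > 2"
    and simple_A: "is_simple_graph n A"
    and connected_A: "is_connected A"
    and binding: "is_binding_graph n A n1 B"
begin

lemma n1: "n1 = n * (n + 1) div 2"
  and simple_B: "is_simple_graph n1 B"
  and base: "\<And>i j. i < n \<Longrightarrow> j < n \<Longrightarrow> B $$ (i, j) = A $$ (i, j)"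
proof -
  from binding[unfolded is_binding_graph_def]
  have "n1 = n * (n + 1) div 2 \<and> is_simple_graph n1 B \<and>
      (\<forall>i<n. \<forall>j<n. B $$ (i, j) = A $$ (i, j))"
    by (elim conjE, intro conjI)
  then show "n1 = n * (n + 1) div 2" "is_simple_graph n1 B"
    "\<And>i j. i < n \<Longrightarrow> j < n \<Longrightarrow> B $$ (i, j) = A $$ (i, j)"
    by blast+
qed

lemma ex_binder:
  assumes "u < n" "v < n" "u \<noteq> v"
  shows "\<exists>p\<in>{n..<n1}. {w. edge B p w} = {u, v}"
proof -
  have "\<forall>u<n. \<forall>v<n. u \<noteq> v \<longrightarrow> (\<exists>!p. p \<in> {n..<n1} \<and> {w. edge B p w} = {u, v})"
    using binding unfolding is_binding_graph_def by (elim conjE)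
  from this[rule_format, OF assms] show ?thesis
    by (rule ex1E) (elim conjE, rule bexI)
qed

lemma n1_eq: "n1 = n + (n choose 2)"
proof -
  have "n * (n + 1) = n * (n - 1) + n * 2"
    by (cases n) (simp_all add: algebra_simps)
  then show ?thesis
    by (simp add: n1 choose_two)
qed

lemma n1_ge: "n1 \<ge> 6"
proof -
  have "3 * 4 \<le> n * (n + 1)"
    using n by (intro mult_mono) auto
  then show ?thesis
    by (simp add: n1)
qed

lemma carrier_B: "B \<in> carrier_mat n1 n1"
  and graph_B: "is_graph n1 B"
  using simple_B by (simp_all add: is_simple_graph_def is_graph_def)

text \<open>Counting shows that \<open>{n..<n1}\<close> contains nothing but binding vertices:
  sending a pair to a vertex that binds it is injective, since the neighbourhood returns the pair,
  and there are as many pairs as vertices in \<open>{n..<n1}\<close>.\<close>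

lemma binder_neighbours:
  assumes "p \<in> {n..<n1}"
  obtains u v where "u < n" "v < n" "u \<noteq> v" "{w. edge B p w} = {u, v}"
proof -
  let ?T = "{s. s \<subseteq> {..<n} \<and> card s = 2}"
  have "\<forall>s\<in>?T. \<exists>p. p \<in> {n..<n1} \<and> {w. edge B p w} = s"
  proof
    fix s assume "s \<in> ?T"
    then obtain u v where uv: "s = {u, v}" "u \<noteq> v" "u < n" "v < n"
      by (auto simp: card_2_iff)
    then show "\<exists>p. p \<in> {n..<n1} \<and> {w. edge B p w} = s"
      using ex_binder[of u v] by blast
  qed
  from bchoice[OF this] obtain f where f: "\<And>s. s \<in> ?T \<Longrightarrow> f s \<in> {n..<n1}"
    "\<And>s. s \<in> ?T \<Longrightarrow> {w. edge B (f s) w} = s"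
    by blast
  have "inj_on f ?T"
    by (rule inj_on_inverseI[of _ "\<lambda>p. {w. edge B p w}"]) (rule f(2))
  then have "card (f ` ?T) = card {n..<n1}"
    by (simp add: card_image n_subsets n1_eq)
  moreover have "f ` ?T \<subseteq> {n..<n1}"
    using f(1) by blast
  ultimately have "f ` ?T = {n..<n1}"
    by (intro card_subset_eq finite_atLeastLessThan)
  then obtain s where s: "s \<in> ?T" "p = f s"
    using assms by blast
  then obtain u v where "s = {u, v}" "u \<noteq> v" "u < n" "v < n"
    by (auto simp: card_2_iff)
  then show thesis
    using that[of u v] f(2)[OF s(1)] s(2) by blast
qed

lemma degree_binder: "p \<in> {n..<n1} \<Longrightarrow> card {w. edge B p w} = 2"
  by (erule binder_neighbours) simp

text \<open>Three neighbours of \<open>u\<close> are exhibited: a neighbour \<open>t\<close> in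
  \<open>A\<close>, the vertex binding \<open>u\<close> with \<open>t\<close>, and the vertex
  binding \<open>u\<close> with some third base vertex \<open>x\<close>.\<close>

lemma degree_base:
  assumes u: "u < n"
  shows "card {w. edge B u w} \<ge> 3"
proof -
  have car: "A \<in> carrier_mat n n"
    using simple_A by (simp add: is_simple_graph_def is_graph_def)
  \<comment> \<open>Any base vertex other than \<open>u\<close> would do; a path from
    \<open>u\<close> to it must start with an edge.\<close>
  define v where "v = (if u = 0 then 1 else (0::nat))"
  have v: "v < n" "v \<noteq> u"
    using n by (auto simp: v_def)
  have "(edge A)\<^sup>*\<^sup>* u v"
    using connected_A car u v by (simp add: is_connected_def)
  then obtain t where "edge A u t"
    using v(2) by (auto elim: converse_rtranclpE)
  then have t: "t < n" "t \<noteq> u" "edge B u t"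
    using u base[of u t] n1_eq unfolding edge_iff[OF carrier_B] edge_iff[OF car] by auto
  have "card ({..<n} - {u, t}) = n - 2"
    using t u by (subst card_Diff_subset) auto
  then have "{..<n} - {u, t} \<noteq> {}"
    using n by (intro notI) simp
  then obtain x where x: "x < n" "x \<noteq> u" "x \<noteq> t"
    by auto
  obtain p where p: "p \<in> {n..<n1}" "{w. edge B p w} = {u, t}"
    using ex_binder[of u t] u t by blast
  obtain q where q: "q \<in> {n..<n1}" "{w. edge B q w} = {u, x}"
    using ex_binder[of u x] u x by blast
  have "edge B p u" "edge B q u"
    using p(2) q(2) by blast+
  then have "{t, p, q} \<subseteq> {w. edge B u w}"
    using t edge_commute[OF graph_B] by blast
  moreover have "finite {w. edge B u w}"
    by (rule finite_subset[of _ "{..<n1}"]) (auto simp: edge_iff[OF carrier_B])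
  ultimately have "card {t, p, q} \<le> card {w. edge B u w}"
    by (intro card_mono)
  moreover have "p \<noteq> q"
    using p(2) q(2) t(2) x by (metis doubleton_eq_iff)
  ultimately show ?thesis
    using p(1) q(1) t(1) by auto
qed

text \<open>Degree 2 against degree at least 3: the diagonal of \<open>Gamma B\<close> tells binding
  vertices from base vertices.\<close>

lemma Gamma_diag_base_iff:
  assumes "i < n1" "s < n1" "Gamma B $$ (i, i) = Gamma B $$ (s, s)"
  shows "i < n \<longleftrightarrow> s < n"
proof -
  have "card {w. edge B i w} = card {w. edge B s w}"
    using n1_ge by (intro Gamma_diag_degree[OF simple_B assms(1,2) _ assms(3)]) simp
  then show ?thesis
    using degree_base[of i] degree_base[of s] degree_binder[of i] degree_binder[of s] assms(1,2)
    by (cases "i < n"; cases "s < n") simp_all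
qed

text \<open>The other two vertices of a triangle through \<open>p\<close> are distinct neighbours of
  \<open>p\<close>, hence are \<open>u\<close> and \<open>v\<close>.\<close>

lemma triangle_binder_iff:
  assumes "{w. edge B p w} = {u, v}"
  shows "(\<exists>x y. edge B p x \<and> edge B x y \<and> edge B y p) \<longleftrightarrow> edge B u v"
proof
  assume "\<exists>x y. edge B p x \<and> edge B x y \<and> edge B y p"
  then obtain x y where xy: "edge B p x" "edge B x y" "edge B y p" by blast
  have "x \<noteq> y"
    using xy by (simp add: edge_def)
  moreover have "x \<in> {u, v}" "y \<in> {u, v}"
    using xy edge_commute[OF graph_B, of y p] by (simp_all flip: assms)
  ultimately show "edge B u v"
    using xy(2) edge_commute[OF graph_B] by blast
next
  assume "edge B u v"
  then show "\<exists>x y. edge B p x \<and> edge B x y \<and> edge B y p"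
    using assms edge_commute[OF graph_B] by blast
qed

text \<open>Adjacency inside the base need not be assumed: it is read off from triangles at binding
  vertices. Two binding vertices are never adjacent, and the mixed pairs are covered by
  \<open>bind\<close>.\<close>

lemma Aut_BI:
  assumes perm: "\<sigma> permutes {..<n1}"
    and diag: "\<And>i. i < n1 \<Longrightarrow> Gamma B $$ (\<sigma> i, \<sigma> i) = Gamma B $$ (i, i)"
    and bind: "\<And>u p. u < n \<Longrightarrow> p \<in> {n..<n1} \<Longrightarrow> edge B (\<sigma> p) (\<sigma> u) \<longleftrightarrow> edge B p u"
  shows "\<sigma> \<in> Aut B"
proof (rule simple_graph_AutI[OF simple_B perm])
  fix i j assume ij: "i < n1" "j < n1"
  have lt: "\<sigma> k < n1 \<longleftrightarrow> k < n1" for k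
    using permutes_in_image[OF perm] by simp
  have lt_n: "\<sigma> k < n \<longleftrightarrow> k < n" if "k < n1" for k
    using Gamma_diag_base_iff[of "\<sigma> k" k] diag that lt by simp
  have indep: "\<not> edge B a b" if ab: "a \<in> {n..<n1}" "b \<in> {n..<n1}" for a b
  proof
    assume edge: "edge B a b"
    obtain u v where uv: "u < n" "v < n" and nb: "{w. edge B a w} = {u, v}"
      using binder_neighbours[OF ab(1)] by blast
    have "b \<in> {u, v}"
      using edge by (simp flip: nb)
    with uv have "b < n"
      by auto
    then show False
      using ab(2) by simp
  qed
  consider "i < n" "j < n" "i = j" | "i < n" "j < n" "i \<noteq> j" | "i < n" "j \<ge> n" | "i \<ge> n" "j < n" | "i \<ge> n" "j \<ge> n"
    by linarith
  then show "edge B (\<sigma> i) (\<sigma> j) \<longleftrightarrow> edge B i j"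
  proof cases
    case 1
    then show ?thesis by (simp add: edge_def)
  next
    case 2
    \<comment> \<open>The image \<open>\<sigma> p\<close> is again a binding vertex and is adjacent
      to the distinct vertices \<open>\<sigma> i\<close> and \<open>\<sigma> j\<close>, so it binds
      exactly this pair. Comparing triangles at \<open>p\<close> and \<open>\<sigma> p\<close> then
      compares the two base pairs.\<close>
    obtain p where p: "p \<in> {n..<n1}" "{w. edge B p w} = {i, j}"
      using ex_binder[of i j] 2 by blast
    have edges: "edge B (\<sigma> p) (\<sigma> i)" "edge B (\<sigma> p) (\<sigma> j)"
      using bind[OF _ p(1)] p(2) 2 by blast+
    have "\<sigma> p \<in> {n..<n1}"
      using lt[of p] lt_n[of p] p(1) by auto
    then obtain u v where nb: "{w. edge B (\<sigma> p) w} = {u, v}"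
      by (rule binder_neighbours)
    have "\<sigma> i \<in> {u, v}" "\<sigma> j \<in> {u, v}"
      using edges by (simp_all flip: nb)
    moreover have "\<sigma> i \<noteq> \<sigma> j"
      using 2 permutes_inj[OF perm] by (simp add: inj_eq)
    ultimately have p': "{w. edge B (\<sigma> p) w} = {\<sigma> i, \<sigma> j}"
      unfolding nb by auto
    show ?thesis
      using Gamma_diag_triangle[OF simple_B, of "\<sigma> p" p] diag[of p] lt[of p] p(1) n1_ge
        triangle_binder_iff[OF p(2)] triangle_binder_iff[OF p'] by simp
  next
    case 3
    then show ?thesis
      using bind[of i j] ij edge_commute[OF graph_B, of i j] edge_commute[OF graph_B, of "\<sigma> i" "\<sigma> j"] by simp
  next
    case 4
    then show ?thesis
      using bind[of j i] ij by simp
  next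
    case 5
    then show ?thesis
      using indep[of i j] indep[of "\<sigma> i" "\<sigma> j"] ij lt[of i] lt[of j] lt_n[of i] lt_n[of j] by auto
  qed
qed

end

section \<open>Comparison of the automorphism groups\<close>

theorem theorem8:
  fixes n n1 :: nat
    and A B M \<Psi> \<Psi>h \<Phi> \<Phi>h :: "label mat"
  assumes "n > 2"
    and "is_simple_graph n A"
    and "is_connected A"
    and "n1 = n * (n + 1) div 2"
    and "is_binding_graph n A n1 B"
    and "is_stable_graph B M"
    and "\<Psi> = mat n1 n1 (\<lambda>(i, j).
           if i \<noteq> j \<and> B $$ (i, j) = X 0 then X 0 else M $$ (i, j))"
    and "\<Phi> = mat n1 n1 (\<lambda>(i, j).
           if i < n \<and> j < n \<and> i \<noteq> j then X 0 else \<Psi> $$ (i, j))"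
    and "is_stable_graph \<Psi> \<Psi>h"
    and "is_stable_graph \<Phi> \<Phi>h"
  shows "Aut B = Aut M \<and> Aut M = Aut \<Psi>h \<and> Aut \<Psi>h = Aut \<Phi>h \<and> Aut \<Phi>h = Aut \<Phi>"
proof -
  interpret binding_graph n n1 A B
    using assms(1-3,5) by unfold_locales
  have N: "n1 \<ge> 2"
    using n1_ge by simp
  note M = stable_graph_properties[OF assms(6) carrier_B N]
  have \<Psi>_car: "\<Psi> \<in> carrier_mat n1 n1" and \<Phi>_car: "\<Phi> \<in> carrier_mat n1 n1"
    by (simp_all add: assms(7,8))
  have \<Psi>: "\<Psi> $$ (i, j) = (if i \<noteq> j \<and> \<not> edge B i j then X 0 else M $$ (i, j))"
    if "i < n1" "j < n1" for i j
    using that edge_iff[OF carrier_B] by (auto simp: assms(7))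
  have \<Phi>: "\<Phi> $$ (i, j) = (if i < n \<and> j < n \<and> i \<noteq> j then X 0 else \<Psi> $$ (i, j))"
    if "i < n1" "j < n1" for i j
    using that by (simp add: assms(8))
  \<comment> \<open>Labels of \<open>M\<close> never collide with \<open>X 0\<close>, so an entry
    \<open>X 0\<close> in \<open>\<Psi>\<close> or \<open>\<Phi>\<close> can only come from the
    masking.\<close>
  have M_nz: "M $$ (i, j) \<noteq> X 0" if "i < n1" "j < n1" for i j
    using M(2)[OF that] by (auto simp: Var_def)
  have AutD: "\<sigma> permutes {..<n1}" "\<And>i j. i < n1 \<Longrightarrow> j < n1 \<Longrightarrow> G $$ (\<sigma> i, \<sigma> j) = G $$ (i, j)"
    "\<And>i. \<sigma> i < n1 \<longleftrightarrow> i < n1" "\<And>i j. \<sigma> i = \<sigma> j \<longleftrightarrow> i = j"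
    if "\<sigma> \<in> Aut G" "G \<in> carrier_mat n1 n1" for \<sigma> G
    using that permutes_in_image[of \<sigma> "{..<n1}"] permutes_inj[of \<sigma> "{..<n1}"] by (auto simp: Aut_def inj_eq)
  have B_\<Psi>: "\<sigma> \<in> Aut \<Psi>" and B_\<Phi>: "\<sigma> \<in> Aut \<Phi>" if \<sigma>: "\<sigma> \<in> Aut B" for \<sigma>
  proof -
    note B' = AutD[OF \<sigma> carrier_B]
    have M': "M $$ (\<sigma> i, \<sigma> j) = M $$ (i, j)" if "i < n1" "j < n1" for i j
      using AutD(2)[OF _ M(4)] \<sigma> M(1) that by blast
    have edges: "edge B (\<sigma> i) (\<sigma> j) \<longleftrightarrow> edge B i j" if "i < n1" "j < n1" for i j
      using B' that by (simp add: edge_iff[OF carrier_B])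
    have \<Psi>': "\<Psi> $$ (\<sigma> i, \<sigma> j) = \<Psi> $$ (i, j)" if "i < n1" "j < n1" for i j
      using that by (simp add: \<Psi> B'(3,4) edges M')
    then show "\<sigma> \<in> Aut \<Psi>"
      using \<Psi>_car B'(1) by (simp add: Aut_def)
    \<comment> \<open>The mask of \<open>\<Phi>\<close> depends on which vertices are in the base,
      so \<sigma> must preserve the base; the diagonal of \<open>M\<close> guarantees it.\<close>
    have "\<sigma> i < n \<longleftrightarrow> i < n" if "i < n1" for i
      using that B'(3) M(3)[of "\<sigma> i" "\<sigma> i" i i] M' by (intro Gamma_diag_base_iff) auto
    then show "\<sigma> \<in> Aut \<Phi>"
      using \<Phi>_car B'(1,3,4) \<Psi>' by (simp add: Aut_def \<Phi>)
  qed
  have \<Psi>_B: "\<sigma> \<in> Aut B" if \<sigma>: "\<sigma> \<in> Aut \<Psi>" for \<sigma>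
  proof -
    note \<Psi>' = AutD[OF \<sigma> \<Psi>_car]
    \<comment> \<open>Off the diagonal, the zero pattern of \<open>\<Psi>\<close> is that of
      \<open>B\<close>.\<close>
    have edge: "edge B i j \<longleftrightarrow> i \<noteq> j \<and> \<Psi> $$ (i, j) \<noteq> X 0" if "i < n1" "j < n1" for i j
      using that M_nz by (auto simp: \<Psi> edge_def)
    show ?thesis
      by (rule simple_graph_AutI[OF simple_B \<Psi>'(1)]) (simp add: edge \<Psi>'(2-4))
  qed
  have \<Phi>_B: "\<sigma> \<in> Aut B" if \<sigma>: "\<sigma> \<in> Aut \<Phi>" for \<sigma>
  proof -
    note \<Phi>' = AutD[OF \<sigma> \<Phi>_car]
    \<comment> \<open>Both masks spare the diagonal, where \<open>\<Phi>\<close> still carries the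
      labels of \<open>M\<close>, and these refine \<open>Gamma B\<close>.\<close>
    have diag: "Gamma B $$ (\<sigma> i, \<sigma> i) = Gamma B $$ (i, i)" if "i < n1" for i
      using \<Phi>'(2)[of i i] that \<Phi>'(3) by (intro M(3)) (simp_all add: \<Phi> \<Psi>)
    have lt_n: "\<sigma> i < n \<longleftrightarrow> i < n" if "i < n1" for i
      using that \<Phi>'(3) diag by (intro Gamma_diag_base_iff) auto
    \<comment> \<open>Pairs of a binding and a base vertex lie outside the block erased in
      \<open>\<Phi>\<close>, so their adjacency survives as the zero pattern.\<close>
    have edge: "edge B p u \<longleftrightarrow> \<Phi> $$ (p, u) \<noteq> X 0" if "u < n" "n \<le> p" "p < n1" for u p
      using that M_nz by (auto simp: \<Phi> \<Psi>)
    have "edge B (\<sigma> p) (\<sigma> u) \<longleftrightarrow> edge B p u" if "u < n" "p \<in> {n..<n1}" for u p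
      using that lt_n[of u] lt_n[of p] \<Phi>'(3)[of p] \<Phi>'(2)[of p u] edge[of u p] edge[of "\<sigma> u" "\<sigma> p"] by auto
    then show ?thesis
      using Aut_BI[OF \<Phi>'(1)] diag by blast
  qed
  have "Aut \<Psi>h = Aut \<Psi>" "Aut \<Phi>h = Aut \<Phi>"
    using stable_graph_properties(1) assms(9,10) \<Psi>_car \<Phi>_car N by blast+
  then show ?thesis
    using M(1) B_\<Psi> \<Psi>_B B_\<Phi> \<Phi>_B by blast
qed

end
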